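(* Every $P$-symmetric ring is generalized weakly symmetric.
   Context: Rings are associative with identity (not necessarily commutative). $N(R)$ denotes the set of all nilpotent elements of a ring $R$, and $P(R)$ its prime radical (the intersection of all prime two-sided ideals of $R$). A ring $R$ is $P$-symmetric if for any $a,b,c\in R$, $abc=0$ implies $bac\in P(R)$. A ring $R$ is generalized weakly symmetric if for any $a,b,c\in R$, $abc=0$ implies $bac\in N(R)$. *)

theory Defs
  imports "HOL-Algebra.Ideal_Product"
begin

text \<open>
  The locale \<open>ring\<close> of HOL-Algebra is the right one: associative, with identity, not necessarily
  commutative, and the zero ring is allowed.  The library locale \<open>primeideal\<close> is not usable here:
  it requires a commutative ring and is phrased in terms of elements rather than ideals.
\<close>

definition prime_two_sided_ideal :: "'a set \<Rightarrow> ('a, 'b) ring_scheme \<Rightarrow> bool" where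
  "prime_two_sided_ideal Q R \<longleftrightarrow>
     ideal Q R \<and> Q \<noteq> carrier R \<and>
     (\<forall>I J. ideal I R \<longrightarrow> ideal J R \<longrightarrow> I \<cdot>\<^bsub>R\<^esub> J \<subseteq> Q \<longrightarrow> I \<subseteq> Q \<or> J \<subseteq> Q)"

text \<open>
  Intersecting with the carrier only matters for the zero ring, which has no prime ideals: the
  empty intersection is taken inside the ring.
\<close>

definition prime_radical :: "('a, 'b) ring_scheme \<Rightarrow> 'a set" where
  "prime_radical R = carrier R \<inter> \<Inter> {Q. prime_two_sided_ideal Q R}"

definition nilpotents :: "('a, 'b) ring_scheme \<Rightarrow> 'a set" where
  "nilpotents R = {x \<in> carrier R. \<exists>n::nat. n > 0 \<and> x [^]\<^bsub>R\<^esub> n = \<zero>\<^bsub>R\<^esub>}"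

definition P_symmetric :: "('a, 'b) ring_scheme \<Rightarrow> bool" where
  "P_symmetric R \<longleftrightarrow>
     (\<forall>a \<in> carrier R. \<forall>b \<in> carrier R. \<forall>c \<in> carrier R.
        a \<otimes>\<^bsub>R\<^esub> b \<otimes>\<^bsub>R\<^esub> c = \<zero>\<^bsub>R\<^esub> \<longrightarrow> b \<otimes>\<^bsub>R\<^esub> a \<otimes>\<^bsub>R\<^esub> c \<in> prime_radical R)"

definition generalized_weakly_symmetric :: "('a, 'b) ring_scheme \<Rightarrow> bool" where
  "generalized_weakly_symmetric R \<longleftrightarrow>
     (\<forall>a \<in> carrier R. \<forall>b \<in> carrier R. \<forall>c \<in> carrier R.
        a \<otimes>\<^bsub>R\<^esub> b \<otimes>\<^bsub>R\<^esub> c = \<zero>\<^bsub>R\<^esub> \<longrightarrow> b \<otimes>\<^bsub>R\<^esub> a \<otimes>\<^bsub>R\<^esub> c \<in> nilpotents R)"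

end

(* The prime radical is a nil ideal: the powers of a non-nilpotent element form a nonempty
   multiplicatively closed set avoiding zero, and an ideal that is maximal among those disjoint
   from such a set is prime, so some prime ideal misses the element. *)
theory Submission
  imports Defs
begin

text \<open>Supplies the upper bounds for Zorn's lemma. Closure under addition is the only point
  where the chain matters: of two members containing \<open>a\<close> and \<open>b\<close>, the
  larger contains both. The other closure properties concern one element and hence one
  member.\<close>

lemma (in ring) ideal_Union_chain:
  assumes "\<C> \<noteq> {}" "subset.chain {I. ideal I R} \<C>"
  shows "ideal (\<Union>\<C>) R"
proof -
  have id: "\<And>I. I \<in> \<C> \<Longrightarrow> ideal I R"
    and tot: "\<And>I J. \<lbrakk>I \<in> \<C>; J \<in> \<C>\<rbrakk> \<Longrightarrow> I \<subseteq> J \<or> J \<subseteq> I"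
    using assms(2) unfolding subset_chain_def by auto
  have sub: "\<And>I. I \<in> \<C> \<Longrightarrow> additive_subgroup I R"
    using id ideal.axioms(1) by blast
  show ?thesis
  proof (rule idealI[OF ring_axioms])
    show "subgroup (\<Union>\<C>) (add_monoid R)"
    proof (rule add.subgroupI)
      show "\<Union>\<C> \<subseteq> carrier R"
        using id ideal.Icarr by fastforce
      show "\<Union>\<C> \<noteq> {}"
        using assms(1) sub additive_subgroup.zero_closed by fastforce
      show "\<ominus> a \<in> \<Union>\<C>" if "a \<in> \<Union>\<C>" for a
        using that sub additive_subgroup.a_subgroup subgroup.m_inv_closed unfolding a_inv_def by fastforce
      show "a \<oplus> b \<in> \<Union>\<C>" if ab: "a \<in> \<Union>\<C>" "b \<in> \<Union>\<C>" for a b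
      proof -
        obtain I where "I \<in> \<C>" "a \<in> I" "b \<in> I"
          using ab tot by blast
        then show ?thesis
          using additive_subgroup.a_closed[OF sub] by blast
      qed
    qed
  next
    fix a x assume "a \<in> \<Union>\<C>" "x \<in> carrier R"
    then show "x \<otimes> a \<in> \<Union>\<C>" "a \<otimes> x \<in> \<Union>\<C>"
      by (auto dest: id intro: ideal.I_l_closed ideal.I_r_closed)
  qed
qed

text \<open>If neither \<open>I\<close> nor \<open>J\<close> lay in \<open>Q\<close>, then
  \<open>Q <+> I\<close> and \<open>Q <+> J\<close> would both meet \<open>S\<close>. The product of
  the two common elements would lie in \<open>S\<close> by closure, but also in \<open>Q\<close>,
  since \<open>I \<cdot> J\<close> does.\<close>

lemma (in ring) prime_ideal_if_maximal_disjoint: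
  assumes Q: "ideal Q R" "Q \<inter> S = {}"
    and max: "\<And>I. \<lbrakk>ideal I R; Q \<subseteq> I; I \<inter> S = {}\<rbrakk> \<Longrightarrow> I = Q"
    and S: "S \<subseteq> carrier R" "S \<noteq> {}" "\<And>s t. \<lbrakk>s \<in> S; t \<in> S\<rbrakk> \<Longrightarrow> s \<otimes> t \<in> S"
  shows "prime_two_sided_ideal Q R"
  unfolding prime_two_sided_ideal_def
proof (intro conjI allI impI)
  show "Q \<noteq> carrier R"
    using Q(2) S(1,2) by blast
next
  fix I J assume IJ: "ideal I R" "ideal J R" "I \<cdot> J \<subseteq> Q"
  interpret Q: ideal Q R by (rule Q(1))
  \<comment> \<open>\<open>Q <+> K\<close> is an ideal strictly larger than \<open>Q\<close>, so
    maximality forces it to meet \<open>S\<close>.\<close>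
  have meet: "\<exists>q\<in>Q. \<exists>k\<in>K. q \<oplus> k \<in> S" if K: "ideal K R" "\<not> K \<subseteq> Q" for K
  proof -
    have "Q \<subseteq> Q <+> K"
    proof
      fix q assume "q \<in> Q"
      moreover have "\<zero> \<in> K"
        using K(1) additive_subgroup.zero_closed ideal.axioms(1) by blast
      ultimately show "q \<in> Q <+> K"
        unfolding set_add_def' using Q.Icarr r_zero by fastforce
    qed
    moreover have "K \<subseteq> Q <+> K"
    proof
      fix k assume k: "k \<in> K"
      then have "k = \<zero> \<oplus> k"
        using ideal.Icarr[OF K(1)] by simp
      then show "k \<in> Q <+> K"
        unfolding set_add_def' using Q.zero_closed k by blast
    qed
    ultimately have "(Q <+> K) \<inter> S \<noteq> {}"
      using max[OF add_ideals[OF Q(1) K(1)]] K(2) by blast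
    then show ?thesis
      unfolding set_add_def' by auto
  qed
  show "I \<subseteq> Q \<or> J \<subseteq> Q"
  proof (rule ccontr)
    assume "\<not> (I \<subseteq> Q \<or> J \<subseteq> Q)"
    then obtain p i q j where el: "p \<in> Q" "i \<in> I" "q \<in> Q" "j \<in> J"
      and s: "p \<oplus> i \<in> S" "q \<oplus> j \<in> S"
      using meet[OF IJ(1)] meet[OF IJ(2)] by blast
    have car: "p \<in> carrier R" "i \<in> carrier R" "q \<in> carrier R" "j \<in> carrier R"
      using Q.Icarr[OF el(1)] ideal.Icarr[OF IJ(1) el(2)] Q.Icarr[OF el(3)]
        ideal.Icarr[OF IJ(2) el(4)] .
    have "i \<otimes> j \<in> Q"
      using subsetD[OF IJ(3) ideal_prod.prod[OF el(2,4)]] .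
    \<comment> \<open>Each summand but \<open>i \<otimes> j\<close> has a factor from
      \<open>Q\<close>: \<open>p\<close> on the left, \<open>q\<close> on the right. Both sides of
      the absorption property of \<open>Q\<close> are used.\<close>
    then have "p \<otimes> (q \<oplus> j) \<oplus> (i \<otimes> q \<oplus> i \<otimes> j) \<in> Q"
      using el car by (simp add: Q.I_l_closed Q.I_r_closed Q.a_closed)
    moreover have "(p \<oplus> i) \<otimes> (q \<oplus> j) = p \<otimes> (q \<oplus> j) \<oplus> (i \<otimes> q \<oplus> i \<otimes> j)"
      \<comment> \<open>Expanding only behind \<open>i\<close> keeps
        \<open>p \<otimes> (q \<oplus> j)\<close> in one piece, as in the grouping above.\<close>
      using car by (simp add: l_distr r_distr[of q j i])
    ultimately show False
      using S(3)[OF s] Q(2) by auto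
  qed
qed (rule Q(1))

text \<open>Zorn's lemma on the ideals disjoint from \<open>S\<close>: the zero ideal is one of them
  because \<open>\<zero> \<notin> S\<close>, and a union of a chain of them stays disjoint from
  \<open>S\<close>.\<close>

lemma (in ring) ex_prime_ideal_disjoint:
  assumes S: "S \<subseteq> carrier R" "S \<noteq> {}" "\<And>s t. \<lbrakk>s \<in> S; t \<in> S\<rbrakk> \<Longrightarrow> s \<otimes> t \<in> S"
    and "\<zero> \<notin> S"
  shows "\<exists>Q. prime_two_sided_ideal Q R \<and> Q \<inter> S = {}"
proof -
  let ?A = "{I. ideal I R \<and> I \<inter> S = {}}"
  have "\<exists>M\<in>?A. \<forall>X\<in>?A. M \<subseteq> X \<longrightarrow> X = M"
  proof (rule subset_Zorn_nonempty)
    show "?A \<noteq> {}"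
      using zeroideal assms(4) by blast
    show "\<Union>\<C> \<in> ?A" if "\<C> \<noteq> {}" "subset.chain ?A \<C>" for \<C>
    proof -
      have "subset.chain {I. ideal I R} \<C>" "\<forall>I\<in>\<C>. I \<inter> S = {}"
        using that(2) unfolding subset_chain_def by auto
      then show ?thesis
        using ideal_Union_chain[OF that(1)] by blast
    qed
  qed
  then obtain M where M: "M \<in> ?A" and max: "\<forall>X\<in>?A. M \<subseteq> X \<longrightarrow> X = M" ..
  have "prime_two_sided_ideal M R"
  proof (rule prime_ideal_if_maximal_disjoint[OF _ _ _ S])
    show "ideal M R" "M \<inter> S = {}"
      using M by simp_all
    show "I = M" if "ideal I R" "M \<subseteq> I" "I \<inter> S = {}" for I
      using max that by simp
  qed
  then show ?thesis
    using M by auto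
qed

lemma (in ring) prime_radical_subset_nilpotents: "prime_radical R \<subseteq> nilpotents R"
proof
  fix x assume x: "x \<in> prime_radical R"
  then have car: "x \<in> carrier R"
    by (simp add: prime_radical_def)
  show "x \<in> nilpotents R"
  proof (rule ccontr)
    assume "x \<notin> nilpotents R"
    \<comment> \<open>Positive exponents, as in \<open>nilpotents\<close>, make
      \<open>\<zero> \<notin> S\<close> a restatement of \<open>x\<close> not being nilpotent. The
      exponent 1 puts \<open>x\<close> itself into \<open>S\<close>, so an ideal disjoint from
      \<open>S\<close> omits \<open>x\<close>.\<close>
    define S where "S = {x [^] n | n::nat. n > 0}"
    have "x [^] (1::nat) \<in> S"
      unfolding S_def by blast
    then have "x \<in> S"
      using car by simp
    moreover have "S \<subseteq> carrier R"
      unfolding S_def using car by auto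
    moreover have "s \<otimes> t \<in> S" if "s \<in> S" "t \<in> S" for s t
      using that car unfolding S_def by (auto simp: nat_pow_mult)
    moreover have "\<zero> \<notin> S"
      using \<open>x \<notin> nilpotents R\<close> car unfolding S_def nilpotents_def by auto
    ultimately obtain Q where "prime_two_sided_ideal Q R" "x \<notin> Q"
      using ex_prime_ideal_disjoint[of S] by blast
    then show False
      using x by (auto simp: prime_radical_def)
  qed
qed

text \<open>The two conditions differ only in the set that must contain
  \<open>b \<otimes> a \<otimes> c\<close>, so the inclusion of the prime radical in the nilpotents
  carries one over to the other.\<close>

theorem theorem2p9:
  fixes R :: "('a, 'b) ring_scheme"
  assumes "ring R" and "P_symmetric R"
  shows "generalized_weakly_symmetric R"
  using assms(2) ring.prime_radical_subset_nilpotents[OF assms(1)]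
  unfolding P_symmetric_def generalized_weakly_symmetric_def by blast

end
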